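(* Let $n\ge 1$ be an integer. For $i=1,\dots,n-1$ the Gauss--Legendre polynomial $F^n_i$ satisfies $$F^n_i(t)=\sum_{k=1}^{n}c^{(i)}_{k}(t+1)^k,\qquad c^{(i)}_{k}:=\frac{n}{2k}\left(P_{n-1}(\tau_i)\,b^{(i)}_{k-1}-P_{n-1}(\tau_{i+1})\,b^{(i+1)}_{k-1}\right)\quad(1\le k\le n).$$ Moreover, $$F^n_0(t)=1-\frac{1}{2}nP_{n-1}(\tau_1)\sum_{k=1}^{n}\frac{1}{k}b^{(1)}_{k-1}(t+1)^k,\qquad F^n_n(t)=\frac{1}{2}nP_{n-1}(\tau_n)\sum_{k=1}^{n}\frac{1}{k}b^{(n)}_{k-1}(t+1)^k.$$ (All identities are identities of polynomials in $t$.)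
   Context: $P_k$ denotes the $k$th Legendre polynomial, normalized by $P_k(1)=1$. For the fixed integer $n\ge1$, $-1<\tau_1<\tau_2<\cdots<\tau_n<1$ are the zeros of $P_n$. For $1\le i\le n$, the real numbers $b^{(i)}_0,\dots,b^{(i)}_{n-1}$ are the coefficients of the polynomial $P_n(x)/(x-\tau_i)$ in the shifted power basis: $\frac{P_n(x)}{x-\tau_i}=\sum_{k=0}^{n-1}b^{(i)}_k(x+1)^k$. Gauss--Legendre polynomials: set $G^n_0(t)\equiv\frac12$, $G^n_{n+1}(t)\equiv-\frac12$, and for $i=1,\dots,n$ $$G^n_i(t):=\frac{nP_{n-1}(\tau_i)}{2}\int_{-1}^{t}\frac{P_n(x)}{x-\tau_i}\,dx-\frac12 .$$ Then $F^n_i(t):=G^n_i(t)-G^n_{i+1}(t)$ for $i=0,1,\dots,n$. *)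

theory Defs
  imports "HOL-Analysis.Analysis" "HOL-Computational_Algebra.Polynomial"
begin

text \<open>Legendre polynomials by Bonnet's recurrence
  $(k+2) P_{k+2}(x) = (2k+3) x P_{k+1}(x) - (k+1) P_k(x)$.\<close>

fun legendre :: "nat \<Rightarrow> real poly" where
  "legendre 0 = 1"
| "legendre (Suc 0) = [:0, 1:]"
| "legendre (Suc (Suc k)) =
     smult (1 / real (k + 2))
       (smult (real (2 * k + 3)) ([:0, 1:] * legendre (Suc k)) - smult (real (k + 1)) (legendre k))"

lemma legendre_at_1: "poly (legendre k) 1 = 1"
  by (induction k rule: legendre.induct) (auto simp: field_simps)

text \<open>The function \<open>\<tau>\<close> lists the zeros of \<open>legendre n\<close> at the indices \<open>1, \<dots>, n\<close>; its
  other values are irrelevant. For such an index, \<open>legendre n div [:- \<tau> i, 1:]\<close> is the exact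
  quotient $P_n(x)/(x-\tau_i)$. The interval integral is oriented, so the formula is also the
  intended polynomial for $t < -1$.\<close>

definition gauss_legendre_G :: "nat \<Rightarrow> (nat \<Rightarrow> real) \<Rightarrow> nat \<Rightarrow> real \<Rightarrow> real" where
  "gauss_legendre_G n \<tau> i t =
     (if i = 0 then 1 / 2
      else if i = n + 1 then - 1 / 2
      else real n * poly (legendre (n - 1)) (\<tau> i) / 2
             * (LBINT x=ereal (-1)..ereal t. poly (legendre n div [:- \<tau> i, 1:]) x) - 1 / 2)"

definition gauss_legendre_F :: "nat \<Rightarrow> (nat \<Rightarrow> real) \<Rightarrow> nat \<Rightarrow> real \<Rightarrow> real" where
  "gauss_legendre_F n \<tau> i t = gauss_legendre_G n \<tau> i t - gauss_legendre_G n \<tau> (i + 1) t"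

end

theory Submission
  imports Defs
begin

text \<open>Integrating the expansion of $P_n(x)/(x-\tau_i)$ in powers of $x+1$ term by term from
  $-1$ to $t$ leaves no constant of integration, because the powers are centred at the lower limit.
  Hence, for $1 \le i \le n$, \<open>G i + 1/2\<close> is a combination of $(t+1)^k/k$ with $k \ge 1$, as stated in
  \<open>gauss_legendre_G_shifted_powers\<close>.  In a difference of two such functions the constants
  \<open>-1/2\<close> cancel, which gives the interior case; at the two ends the conventions
  \<open>G 0 = 1/2\<close> and \<open>G (n + 1) = -1/2\<close> leave the constants \<open>1\<close> and \<open>0\<close>.\<close>

text \<open>An explicit primitive that vanishes at \<open>-1\<close> reduces the claim to the fundamental theorem of
  calculus.  Its oriented form covers \<open>t < -1\<close> as well, so the identity holds for all real \<open>t\<close>.\<close>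

lemma interval_integral_shifted_powers:
  fixes a :: "nat \<Rightarrow> real" and t :: real
  shows "(LBINT x=ereal (-1)..ereal t. (\<Sum>k<n. a k * (x + 1) ^ k))
         = (\<Sum>k=1..n. 1 / real k * a (k - 1) * (t + 1) ^ k)"
proof -
  define H where "H x = (\<Sum>k<n. a k / real (Suc k) * (x + 1) ^ Suc k)" for x :: real
  have deriv: "(H has_real_derivative (\<Sum>k<n. a k * (x + 1) ^ k)) (at x within S)" for x S
    unfolding H_def
    by (auto intro!: derivative_eq_intros sum.cong simp del: power_Suc of_nat_Suc)
  have "(LBINT x=ereal (-1)..ereal t. (\<Sum>k<n. a k * (x + 1) ^ k)) = H t - H (-1)"
    by (rule interval_integral_FTC_finite)
       (auto intro!: continuous_intros deriv[unfolded has_real_derivative_iff_has_vector_derivative])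
  also have "\<dots> = (\<Sum>k<n. 1 / real (Suc k) * a k * (t + 1) ^ Suc k)"
    by (simp add: H_def)
  also have "\<dots> = (\<Sum>k=1..n. 1 / real k * a (k - 1) * (t + 1) ^ k)"
    by (rule sum.reindex_bij_witness[of _ "\<lambda>k. k - 1" Suc]) auto
  finally show ?thesis .
qed

lemma gauss_legendre_G_shifted_powers:
  assumes "i \<in> {1..n}"
    and expansion: "legendre n div [:- \<tau> i, 1:] = (\<Sum>k=0..n-1. smult (a k) ([:1, 1:] ^ k))"
  shows "gauss_legendre_G n \<tau> i t =
           real n * poly (legendre (n - 1)) (\<tau> i) / 2
             * (\<Sum>k=1..n. 1 / real k * a (k - 1) * (t + 1) ^ k) - 1 / 2"
proof -
  have "{0..n-1} = {..<n}"
    using assms(1) by auto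
  then have "poly (legendre n div [:- \<tau> i, 1:]) = (\<lambda>x. \<Sum>k<n. a k * (x + 1) ^ k)"
    by (simp add: fun_eq_iff expansion poly_sum poly_power add.commute)
  then show ?thesis
    using assms(1) interval_integral_shifted_powers[of t a n]
    by (simp add: gauss_legendre_G_def)
qed

theorem theorem4p3:
  fixes n :: nat and \<tau> :: "nat \<Rightarrow> real" and b :: "nat \<Rightarrow> nat \<Rightarrow> real"
  assumes "n \<ge> 1"
    and "strict_mono_on {1..n} \<tau>"
    and "\<tau> ` {1..n} = {x. poly (legendre n) x = 0}"
    and "\<And>i. i \<in> {1..n} \<Longrightarrow> -1 < \<tau> i \<and> \<tau> i < 1"
    and "\<And>i. i \<in> {1..n} \<Longrightarrow>
           legendre n div [:- \<tau> i, 1:] = (\<Sum>k=0..n-1. smult (b i k) ([:1, 1:] ^ k))"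
  shows "(\<forall>i\<in>{1..n-1}. \<forall>t. gauss_legendre_F n \<tau> i t =
            (\<Sum>k=1..n. real n / (2 * real k)
               * (poly (legendre (n - 1)) (\<tau> i) * b i (k - 1)
                  - poly (legendre (n - 1)) (\<tau> (i + 1)) * b (i + 1) (k - 1))
               * (t + 1) ^ k))
       \<and> (\<forall>t. gauss_legendre_F n \<tau> 0 t =
            1 - 1 / 2 * real n * poly (legendre (n - 1)) (\<tau> 1)
                  * (\<Sum>k=1..n. 1 / real k * b 1 (k - 1) * (t + 1) ^ k))
       \<and> (\<forall>t. gauss_legendre_F n \<tau> n t =
            1 / 2 * real n * poly (legendre (n - 1)) (\<tau> n)
                  * (\<Sum>k=1..n. 1 / real k * b n (k - 1) * (t + 1) ^ k))"
proof (intro conjI ballI allI)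
  have G: "gauss_legendre_G n \<tau> i t =
      real n * poly (legendre (n - 1)) (\<tau> i) / 2
        * (\<Sum>k=1..n. 1 / real k * b i (k - 1) * (t + 1) ^ k) - 1 / 2" if "i \<in> {1..n}" for i t
    using that assms(5)[OF that] by (rule gauss_legendre_G_shifted_powers)
  {
    fix i t
    assume "i \<in> {1..n-1}"
    then have "i \<in> {1..n}" "i + 1 \<in> {1..n}"
      by auto
    then show "gauss_legendre_F n \<tau> i t =
            (\<Sum>k=1..n. real n / (2 * real k)
               * (poly (legendre (n - 1)) (\<tau> i) * b i (k - 1)
                  - poly (legendre (n - 1)) (\<tau> (i + 1)) * b (i + 1) (k - 1))
               * (t + 1) ^ k)"
      unfolding gauss_legendre_F_def
      by (simp only: G, simp add: sum_distrib_left flip: sum_subtractf)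
         (auto intro!: sum.cong simp: field_simps)
  next
    fix t
    show "gauss_legendre_F n \<tau> 0 t =
            1 - 1 / 2 * real n * poly (legendre (n - 1)) (\<tau> 1)
                  * (\<Sum>k=1..n. 1 / real k * b 1 (k - 1) * (t + 1) ^ k)"
      using G[of 1 t] \<open>n \<ge> 1\<close>
      by (simp add: gauss_legendre_F_def gauss_legendre_G_def[of n \<tau> 0])
  next
    fix t
    show "gauss_legendre_F n \<tau> n t =
            1 / 2 * real n * poly (legendre (n - 1)) (\<tau> n)
                  * (\<Sum>k=1..n. 1 / real k * b n (k - 1) * (t + 1) ^ k)"
      using G[of n t] \<open>n \<ge> 1\<close>
      by (simp add: gauss_legendre_F_def gauss_legendre_G_def[of n \<tau> "Suc n"])
  }
qed

end
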